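(* Let $d \geq 2$ be an integer, let $\mathbb{F}$ be a field, and let $V$ be a vector space over $\mathbb{F}$ of dimension $d+1$. Let $\Phi = (A; \{E_i\}_{i=0}^d; A^*; \{E^*_i\}_{i=0}^d)$ be a Hessenberg system on $V$. Then $\Phi$ is a Quasi-Circular Hessenberg system (QCHS) if and only if $\Phi$ is TD.
   Context: $\mathrm{End}(V)$ is the algebra of $\mathbb{F}$-linear maps $V\to V$. An element of $\mathrm{End}(V)$ is multiplicity-free if it is diagonalizable and every eigenspace has dimension one. For multiplicity-free $A$ with eigenspaces ordered $V_0,\dots,V_d$, the corresponding primitive idempotents are $E_0,\dots,E_d \in \mathrm{End}(V)$, where $E_i$ acts as the identity on $V_i$ and as $0$ on $V_j$ for $j\neq i$. The superscript $*$ in $A^*$, $E_i^*$ is just notation (not an adjoint). A Hessenberg system on $V$ is a sequence $\Phi=(A; \{E_i\}_{i=0}^d; A^*; \{E^*_i\}_{i=0}^d)$ of elements of $\mathrm{End}(V)$ such that: (i) $A$ and $A^*$ are multiplicity-free; (ii) $\{E_i\}_{i=0}^d$ is an ordering of the primitive idempotents of $A$; (iii) $\{E^*_i\}_{i=0}^d$ is an ordering of the primitive idempotents of $A^*$; (iv) for $0\le i,j\le d$, $E_iA^*E_j=0$ if $i-j>1$ and $E_iA^*E_j\neq 0$ if $i-j=1$; (v) for $0\le i,j\le d$, $E^*_iAE^*_j=0$ if $i-j>1$ and $E^*_iAE^*_j\neq 0$ if $i-j=1$. A Hessenberg system $\Phi$ is a Quasi-Circular Hessenberg system (QCHS) if for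 all $0\le i,j\le d$ with $1<j-i<d$ we have $E_iA^*E_j=0$ and $E^*_iAE^*_j=0$. A Hessenberg system $\Phi$ is TD if there exist scalars $\beta,\gamma,\gamma^*,\varrho,\varrho^*\in\mathbb{F}$ such that $$0=[A, A^2A^*-\beta AA^*A+A^*A^2-\gamma(AA^*+A^*A)-\varrho A^*],$$ $$0=[A^*, A^{*2}A-\beta A^*AA^*+AA^{*2}-\gamma^*(A^*A+AA^* )-\varrho^*A],$$ where $[X,Y]=XY-YX$. *)

theory Defs
  imports Complex_Main
begin

text \<open>The ambient space \<open>V\<close> is the whole type \<open>'v\<close>, regarded as a vector space over the
  field \<open>'f\<close> with scalar multiplication \<open>s\<close>. The algebra \<open>End(V)\<close> consists of the linear
  functions \<open>'v \<Rightarrow> 'v\<close>, with composition as product. A family indexed by \<open>0 \<le> i \<le> d\<close> is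
  a function on \<open>nat\<close> whose values beyond \<open>d\<close> are irrelevant. The name \<open>As\<close> stands for
  \<open>A\<^sup>*\<close>, and \<open>Es\<close> for the family of the \<open>E\<^sup>*\<^sub>i\<close>. The definitions take \<open>s\<close> as an
  explicit argument and are intended for \<open>vector_space s\<close>; they are kept out of that locale
  because its global interpretation for real vector spaces captures the constant names.\<close>

definition eigenspace :: "('f::field \<Rightarrow> 'v::ab_group_add \<Rightarrow> 'v) \<Rightarrow> ('v \<Rightarrow> 'v) \<Rightarrow> 'f \<Rightarrow> 'v set" where
  "eigenspace s f c = {v. f v = s c v}"

definition eigenvalue :: "('f::field \<Rightarrow> 'v::ab_group_add \<Rightarrow> 'v) \<Rightarrow> ('v \<Rightarrow> 'v) \<Rightarrow> 'f \<Rightarrow> bool" where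
  "eigenvalue s f c \<longleftrightarrow> (\<exists>v. v \<noteq> 0 \<and> f v = s c v)"

definition eigenspaces :: "('f::field \<Rightarrow> 'v::ab_group_add \<Rightarrow> 'v) \<Rightarrow> ('v \<Rightarrow> 'v) \<Rightarrow> 'v set set" where
  "eigenspaces s f = {eigenspace s f c | c. eigenvalue s f c}"

definition diagonalizable :: "('f::field \<Rightarrow> 'v::ab_group_add \<Rightarrow> 'v) \<Rightarrow> ('v \<Rightarrow> 'v) \<Rightarrow> bool" where
  "diagonalizable s f \<longleftrightarrow>
    (\<exists>B. \<not> module.dependent s B \<and> module.span s B = UNIV \<and> (\<forall>b\<in>B. \<exists>c. f b = s c b))"

definition multiplicity_free :: "('f::field \<Rightarrow> 'v::ab_group_add \<Rightarrow> 'v) \<Rightarrow> ('v \<Rightarrow> 'v) \<Rightarrow> bool" where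
  "multiplicity_free s f \<longleftrightarrow>
    Vector_Spaces.linear s s f \<and> diagonalizable s f \<and>
    (\<forall>W\<in>eigenspaces s f. vector_space.dim s W = 1)"

definition primitive_idempotent_ordering ::
    "('f::field \<Rightarrow> 'v::ab_group_add \<Rightarrow> 'v) \<Rightarrow> nat \<Rightarrow> ('v \<Rightarrow> 'v) \<Rightarrow> (nat \<Rightarrow> 'v \<Rightarrow> 'v) \<Rightarrow> bool" where
  "primitive_idempotent_ordering s d f E \<longleftrightarrow>
    (\<exists>W. bij_betw W {0..d} (eigenspaces s f) \<and>
      (\<forall>i\<le>d. Vector_Spaces.linear s s (E i) \<and>
        (\<forall>v\<in>W i. E i v = v) \<and>
        (\<forall>j\<le>d. j \<noteq> i \<longrightarrow> (\<forall>v\<in>W j. E i v = 0))))"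

definition hessenberg_system ::
    "('f::field \<Rightarrow> 'v::ab_group_add \<Rightarrow> 'v) \<Rightarrow> nat \<Rightarrow>
      ('v \<Rightarrow> 'v) \<Rightarrow> (nat \<Rightarrow> 'v \<Rightarrow> 'v) \<Rightarrow> ('v \<Rightarrow> 'v) \<Rightarrow> (nat \<Rightarrow> 'v \<Rightarrow> 'v) \<Rightarrow> bool" where
  "hessenberg_system s d A E As Es \<longleftrightarrow>
    multiplicity_free s A \<and> multiplicity_free s As \<and>
    primitive_idempotent_ordering s d A E \<and>
    primitive_idempotent_ordering s d As Es \<and>
    (\<forall>i\<le>d. \<forall>j\<le>d.
      (int i - int j > 1 \<longrightarrow> E i \<circ> As \<circ> E j = (\<lambda>v. 0)) \<and>
      (int i - int j = 1 \<longrightarrow> E i \<circ> As \<circ> E j \<noteq> (\<lambda>v. 0))) \<and>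
    (\<forall>i\<le>d. \<forall>j\<le>d.
      (int i - int j > 1 \<longrightarrow> Es i \<circ> A \<circ> Es j = (\<lambda>v. 0)) \<and>
      (int i - int j = 1 \<longrightarrow> Es i \<circ> A \<circ> Es j \<noteq> (\<lambda>v. 0)))"

definition QCHS ::
    "('f::field \<Rightarrow> 'v::ab_group_add \<Rightarrow> 'v) \<Rightarrow> nat \<Rightarrow>
      ('v \<Rightarrow> 'v) \<Rightarrow> (nat \<Rightarrow> 'v \<Rightarrow> 'v) \<Rightarrow> ('v \<Rightarrow> 'v) \<Rightarrow> (nat \<Rightarrow> 'v \<Rightarrow> 'v) \<Rightarrow> bool" where
  "QCHS s d A E As Es \<longleftrightarrow>
    hessenberg_system s d A E As Es \<and>
    (\<forall>i\<le>d. \<forall>j\<le>d. 1 < int j - int i \<and> int j - int i < int d \<longrightarrow>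
      E i \<circ> As \<circ> E j = (\<lambda>v. 0) \<and> Es i \<circ> A \<circ> Es j = (\<lambda>v. 0))"

definition commutator :: "('v::ab_group_add \<Rightarrow> 'v) \<Rightarrow> ('v \<Rightarrow> 'v) \<Rightarrow> 'v \<Rightarrow> 'v" where
  "commutator X Y = (\<lambda>v. X (Y v) - Y (X v))"

text \<open>For \<open>X, Y\<close> in \<open>End(V)\<close>, the following is
  \<open>X\<^sup>2 Y - \<beta> X Y X + Y X\<^sup>2 - \<gamma> (X Y + Y X) - \<rho> Y\<close>.\<close>

definition td_expr :: "('f::field \<Rightarrow> 'v::ab_group_add \<Rightarrow> 'v) \<Rightarrow> 'f \<Rightarrow> 'f \<Rightarrow> 'f \<Rightarrow>
    ('v \<Rightarrow> 'v) \<Rightarrow> ('v \<Rightarrow> 'v) \<Rightarrow> 'v \<Rightarrow> 'v" where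
  "td_expr s \<beta> \<gamma> \<rho> X Y = (\<lambda>v.
    X (X (Y v)) - s \<beta> (X (Y (X v))) + Y (X (X v))
    - s \<gamma> (X (Y v) + Y (X v)) - s \<rho> (Y v))"

definition TD ::
    "('f::field \<Rightarrow> 'v::ab_group_add \<Rightarrow> 'v) \<Rightarrow> nat \<Rightarrow>
      ('v \<Rightarrow> 'v) \<Rightarrow> (nat \<Rightarrow> 'v \<Rightarrow> 'v) \<Rightarrow> ('v \<Rightarrow> 'v) \<Rightarrow> (nat \<Rightarrow> 'v \<Rightarrow> 'v) \<Rightarrow> bool" where
  "TD s d A E As Es \<longleftrightarrow>
    hessenberg_system s d A E As Es \<and>
    (\<exists>\<beta> \<gamma> \<gamma>s \<rho> \<rho>s.
      commutator A (td_expr s \<beta> \<gamma> \<rho> A As) = (\<lambda>v. 0) \<and>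
      commutator As (td_expr s \<beta> \<gamma>s \<rho>s As A) = (\<lambda>v. 0))"

end

theory Submission
  imports Defs "HOL-Computational_Algebra.Polynomial"
begin

text \<open>In an eigenbasis of \<open>A\<close>, with eigenvalues \<open>\<theta>\<^sub>i\<close>, the first TD relation says that the symmetric
  quadratic \<open>P(x,y) = x\<^sup>2 - \<beta> x y + y\<^sup>2 - \<gamma> (x + y) - \<rho>\<close> vanishes at \<open>(\<theta>\<^sub>i, \<theta>\<^sub>j)\<close> whenever \<open>i \<noteq> j\<close> and
  \<open>E\<^sub>i A\<^sup>* E\<^sub>j \<noteq> 0\<close>. If TD holds, then the neighbours of \<open>\<theta>\<^sub>i\<close> are the only roots of \<open>P(\<theta>\<^sub>i, y)\<close> for
  \<open>0 < i < d\<close>, which forces the quasi-circular shape.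

  Conversely let \<open>d \<ge> 3\<close> (for \<open>d = 2\<close> take \<open>\<beta> = -1\<close>, so that \<open>P\<close> is the divided difference of the
  characteristic polynomial of \<open>A\<close>). Choose a polynomial \<open>Z\<close> in \<open>A\<close> such that
  \<open>D = A\<^sup>2 A\<^sup>* A - A A\<^sup>* A\<^sup>2 - [Z, A\<^sup>*]\<close> is a multiple of the corner \<open>E\<^sub>0 A\<^sup>* E\<^sub>d\<close>. In an eigenbasis of \<open>A\<^sup>*\<close> the
  diagonal of \<open>D\<close> vanishes: a commutator with \<open>A\<^sup>*\<close> has zero diagonal, and closed walks of length 3
  on a cycle with more than 3 vertices cancel against their reversals. Hence the product of \<open>D\<close> with
  the \<open>d\<close>-th power of \<open>A\<^sup>*\<close> has trace 0, whereas the \<open>(d, 0)\<close> entry of that power in the eigenbasis of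
  \<open>A\<close> is nonzero by the Hessenberg shape; so \<open>D = 0\<close>. As \<open>A\<close> is upper Hessenberg in the eigenbasis of
  \<open>A\<^sup>*\<close>, comparing the lowest nonzero subdiagonals shows that \<open>Z\<close> has degree exactly 3, and \<open>D = 0\<close>
  becomes the first TD relation, with \<open>(\<beta> + 1) (\<theta>\<^sup>*\<^sub>1 - \<theta>\<^sup>*\<^sub>2) = \<theta>\<^sup>*\<^sub>0 - \<theta>\<^sup>*\<^sub>3\<close>. By symmetry the second
  relation holds with the dual value of \<open>\<beta>\<close>, and the first relation implies that the two values
  agree.\<close>

section \<open>Coordinates in an eigenbasis\<close>

text \<open>\<open>\<phi>\<close> is the dual basis of \<open>u\<close>, so for a linear map
  \<open>X\<close> the scalar \<open>\<phi> i (X (u j))\<close> is its \<open>(i, j)\<close> matrix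
  entry.\<close>

locale eigenbasis = vector_space s
  for s :: "'f::field \<Rightarrow> 'v::ab_group_add \<Rightarrow> 'v" +
  fixes d :: nat and A :: "'v \<Rightarrow> 'v" and \<theta> :: "nat \<Rightarrow> 'f" and u :: "nat \<Rightarrow> 'v"
    and \<phi> :: "nat \<Rightarrow> 'v \<Rightarrow> 'f"
  assumes A_add: "A (v + w) = A v + A w"
    and A_scale: "A (s c v) = s c (A v)"
    and eigenvector: "i \<le> d \<Longrightarrow> A (u i) = s (\<theta> i) (u i)"
    and coord_add: "i \<le> d \<Longrightarrow> \<phi> i (v + w) = \<phi> i v + \<phi> i w"
    and coord_scale: "i \<le> d \<Longrightarrow> \<phi> i (s c v) = c * \<phi> i v"
    and coord_basis: "i \<le> d \<Longrightarrow> j \<le> d \<Longrightarrow> \<phi> i (u j) = (if i = j then 1 else 0)"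
    and expansion: "v = (\<Sum>i\<le>d. s (\<phi> i v) (u i))"
    and inj_eigenvalues: "inj_on \<theta> {..d}"
begin

lemma A_diff: "A (v - w) = A v - A w"
  using A_add[of "v - w" w] by (simp add: algebra_simps)

lemma coord_zero: "i \<le> d \<Longrightarrow> \<phi> i 0 = 0"
  using coord_scale[of i 0 0] by simp

lemma coord_sum: "i \<le> d \<Longrightarrow> \<phi> i (sum g I) = (\<Sum>j\<in>I. \<phi> i (g j))"
  by (induction I rule: infinite_finite_induct) (auto simp: coord_zero coord_add)

lemma coord_diff: "i \<le> d \<Longrightarrow> \<phi> i (v - w) = \<phi> i v - \<phi> i w"
  using coord_add[of i "v - w" w] by (simp add: algebra_simps)

lemma eq_zeroI: "(\<And>i. i \<le> d \<Longrightarrow> \<phi> i v = 0) \<Longrightarrow> v = 0"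
  by (subst expansion) simp

lemma eigenvalue_neq: "i \<le> d \<Longrightarrow> j \<le> d \<Longrightarrow> i \<noteq> j \<Longrightarrow> \<theta> i \<noteq> \<theta> j"
  using inj_eigenvalues by (auto simp: inj_on_def)

lemma functional_expansion:
  assumes add: "\<And>v w. g (v + w) = g v + g w" and scale: "\<And>c v. g (s c v) = c * g v"
  shows "g v = (\<Sum>j\<le>d. \<phi> j v * g (u j))"
proof -
  have zero: "g 0 = 0" using scale[of 0 0] by simp
  have gsum: "g (sum h I) = (\<Sum>i\<in>I. g (h i))" for h and I :: "nat set"
    by (induction I rule: infinite_finite_induct) (auto simp: zero add)
  have "g v = g (\<Sum>j\<le>d. s (\<phi> j v) (u j))" by (subst expansion) simp
  then show ?thesis by (simp add: gsum scale)
qed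

lemma coord_A: assumes "i \<le> d" shows "\<phi> i (A v) = \<theta> i * \<phi> i v"
proof -
  have "\<phi> i (A v) = (\<Sum>j\<le>d. \<phi> j v * \<phi> i (A (u j)))"
    by (rule functional_expansion) (use assms in \<open>simp_all add: A_add A_scale coord_add coord_scale\<close>)
  also have "\<dots> = (\<Sum>j\<le>d. if j = i then \<phi> j v * \<theta> i else 0)"
    by (rule sum.cong) (use assms in \<open>auto simp: eigenvector coord_scale coord_basis\<close>)
  also have "\<dots> = \<theta> i * \<phi> i v" using assms by simp
  finally show ?thesis .
qed

lemma coord_A_funpow: "i \<le> d \<Longrightarrow> \<phi> i ((A ^^ k) v) = \<theta> i ^ k * \<phi> i v"
  by (induction k) (auto simp: coord_A algebra_simps)

end

text \<open>Diagonalizability gives a spanning set of eigenvectors, each lying on one of the lines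
  \<open>W i\<close>. As \<open>E i\<close> projects onto the line of \<open>u i\<close>, the
  coordinate \<open>\<phi> i v\<close> is read off from \<open>E i v\<close>.\<close>

lemma eigenbasis_exists:
  fixes s :: "'f::field \<Rightarrow> 'v::ab_group_add \<Rightarrow> 'v"
  assumes vs: "vector_space s" and mf: "multiplicity_free s A"
    and ord: "primitive_idempotent_ordering s d A E"
  obtains \<theta> u \<phi> where "eigenbasis s d A \<theta> u \<phi>"
    and "\<And>i v. i \<le> d \<Longrightarrow> E i v = s (\<phi> i v) (u i)" and "\<And>i. i \<le> d \<Longrightarrow> u i \<noteq> 0"
proof -
  interpret vector_space s by (rule vs)
  from ord obtain W where bij: "bij_betw W {0..d} (eigenspaces s A)"
    and E_lin: "\<And>i. i \<le> d \<Longrightarrow> Vector_Spaces.linear s s (E i)"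
    and E_id: "\<And>i v. i \<le> d \<Longrightarrow> v \<in> W i \<Longrightarrow> E i v = v"
    and E_0: "\<And>i j v. i \<le> d \<Longrightarrow> j \<le> d \<Longrightarrow> j \<noteq> i \<Longrightarrow> v \<in> W j \<Longrightarrow> E i v = 0"
    unfolding primitive_idempotent_ordering_def by blast
  have A_lin: "Vector_Spaces.linear s s A" and diag: "diagonalizable s A"
    and dim1: "\<And>X. X \<in> eigenspaces s A \<Longrightarrow> dim X = 1"
    using mf unfolding multiplicity_free_def by auto
  interpret AL: Vector_Spaces.linear s s A by (rule A_lin)
  have W_in: "W i \<in> eigenspaces s A" if "i \<le> d" for i
    using bij that by (auto simp: bij_betw_def)
  have "\<exists>c. W i = eigenspace s A c \<and> eigenvalue s A c" if "i \<le> d" for i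
    using W_in[OF that] by (auto simp: eigenspaces_def)
  then obtain \<theta> where \<theta>: "\<And>i. i \<le> d \<Longrightarrow> W i = eigenspace s A (\<theta> i)"
    by metis
  have "\<exists>v. v \<noteq> 0 \<and> v \<in> W i \<and> W i \<subseteq> range (\<lambda>c. s c v)" if "i \<le> d" for i
  proof -
    obtain B where B: "B \<subseteq> W i" "independent B" "W i \<subseteq> span B" "card B = dim (W i)"
      using basis_exists by metis
    then have "card B = 1" using dim1[OF W_in[OF that]] by simp
    then obtain v where v: "B = {v}" by (auto simp: card_1_singleton_iff)
    with B have "v \<noteq> 0" using dependent_zero[of B] by auto
    then show ?thesis using B v by (auto simp: span_singleton)
  qed
  then obtain u where u0: "\<And>i. i \<le> d \<Longrightarrow> u i \<noteq> 0" and uW: "\<And>i. i \<le> d \<Longrightarrow> u i \<in> W i"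
    and Wu: "\<And>i. i \<le> d \<Longrightarrow> W i \<subseteq> range (\<lambda>c. s c (u i))"
    by metis
  have eig: "A (u i) = s (\<theta> i) (u i)" if "i \<le> d" for i
    using uW[OF that] \<theta>[OF that] by (simp add: eigenspace_def)
  have E_add: "E i (v + w) = E i v + E i w" and E_scale: "E i (s c v) = s c (E i v)"
    if "i \<le> d" for i c v w
  proof -
    interpret EL: Vector_Spaces.linear s s "E i" using E_lin that by simp
    show "E i (v + w) = E i v + E i w" "E i (s c v) = s c (E i v)"
      by (simp_all add: EL.add EL.scale)
  qed
  have E_zero: "E i 0 = 0" if "i \<le> d" for i using E_add[OF that, of 0 0] by simp
  have E_u: "E i (u j) = (if i = j then u i else 0)" if "i \<le> d" "j \<le> d" for i j
    using that E_id E_0 uW by auto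
  have "module.span s (u ` {..d}) = UNIV"
  proof -
    obtain B where B: "span B = UNIV" "\<forall>b\<in>B. \<exists>c. A b = s c b"
      using diag unfolding diagonalizable_def by auto
    have "b \<in> span (u ` {..d})" if bB: "b \<in> B" for b
    proof (cases "b = 0")
      case True then show ?thesis by (simp add: span_zero)
    next
      case False
      obtain c where c: "A b = s c b" using B bB by auto
      then have "eigenspace s A c \<in> eigenspaces s A"
        using False by (auto simp: eigenspaces_def eigenvalue_def)
      then obtain i where i: "i \<le> d" "W i = eigenspace s A c"
        using bij by (auto simp: bij_betw_def image_iff) (metis (mono_tags) atLeastAtMost_iff imageE)
      then have "b \<in> W i" using c by (simp add: eigenspace_def)
      then obtain k where "b = s k (u i)" using Wu[OF i(1)] by auto
      then show ?thesis using i by (simp add: span_scale span_base)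
    qed
    then show ?thesis using B span_minimal[of B "span (u ` {..d})"] by auto
  qed
  then have spans: "v \<in> span (u ` {..d})" for v by simp
  \<comment> \<open>One induction over the span shows that the \<open>E i\<close> sum to the
    identity and that each maps into its line.\<close>
  have ex: "v = (\<Sum>i\<le>d. E i v) \<and> (\<forall>i\<le>d. \<exists>c. E i v = s c (u i))" for v
    using spans[of v]
  proof (induction rule: span_induct_alt)
    case base
    show ?case by (auto simp: E_zero intro: exI[of _ 0])
  next
    case (step c x y)
    then obtain j where j: "j \<le> d" "x = u j" by auto
    have "(\<Sum>i\<le>d. E i (s c x + y)) = (\<Sum>i\<le>d. s c (E i x)) + (\<Sum>i\<le>d. E i y)"
      by (simp add: E_add E_scale sum.distrib)
    also have "(\<Sum>i\<le>d. s c (E i x)) = (\<Sum>i\<le>d. if i = j then s c (u j) else 0)"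
      by (rule sum.cong) (auto simp: j E_u)
    also have "\<dots> = s c x" using j by simp
    finally have 1: "s c x + y = (\<Sum>i\<le>d. E i (s c x + y))" using step by simp
    have "\<exists>k. E i (s c x + y) = s k (u i)" if i: "i \<le> d" for i
    proof -
      obtain m where m: "E i y = s m (u i)" using step i by auto
      have "E i (s c x + y) = s ((if i = j then c else 0) + m) (u i)"
        using i j m by (simp add: E_add E_scale E_u scale_left_distrib)
      then show ?thesis by blast
    qed
    with 1 show ?case by blast
  qed
  then have "\<exists>c. i \<le> d \<longrightarrow> E i v = s c (u i)" for i v by blast
  then obtain \<phi> where \<phi>: "\<And>i v. i \<le> d \<Longrightarrow> E i v = s (\<phi> i v) (u i)" by metis
  have cancel: "c = c'" if "i \<le> d" "s c (u i) = s c' (u i)" for i c c'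
    using that u0[OF that(1)] by simp
  have "eigenbasis s d A \<theta> u \<phi>"
  proof
    show "A (v + w) = A v + A w" for v w by (rule AL.add)
    show "A (s c v) = s c (A v)" for c v by (rule AL.scale)
    show "A (u i) = s (\<theta> i) (u i)" if "i \<le> d" for i by (rule eig[OF that])
    show "\<phi> i (v + w) = \<phi> i v + \<phi> i w" if "i \<le> d" for i v w
      by (rule cancel[OF that]) (use that \<phi> E_add in \<open>metis scale_left_distrib\<close>)
    show "\<phi> i (s c v) = c * \<phi> i v" if "i \<le> d" for i c v
      by (rule cancel[OF that]) (use that \<phi> E_scale in \<open>metis scale_scale\<close>)
    show "\<phi> i (u j) = (if i = j then 1 else 0)" if "i \<le> d" "j \<le> d" for i j
      by (rule cancel[OF that(1)]) (use that in \<open>simp add: \<phi>[symmetric] E_u\<close>)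
    show "v = (\<Sum>i\<le>d. s (\<phi> i v) (u i))" for v
      using ex[of v] \<phi> by simp
    show "inj_on \<theta> {..d}"
    proof (rule inj_onI)
      fix i j assume ij: "i \<in> {..d}" "j \<in> {..d}" "\<theta> i = \<theta> j"
      then have "W i = W j" using \<theta> by simp
      then show "i = j" using ij bij by (auto simp: bij_betw_def inj_on_def)
    qed
  qed
  then show thesis using that \<phi> u0 by blast
qed

section \<open>Matrix entries and Hessenberg shape\<close>

locale hessenberg_pair = A: eigenbasis s d A \<theta> u \<phi> + B: eigenbasis s d B \<theta>' w \<psi>
  for s :: "'f::field \<Rightarrow> 'v::ab_group_add \<Rightarrow> 'v" and d A \<theta> u \<phi> B \<theta>' w \<psi> +
  assumes B_hess0: "i \<le> d \<Longrightarrow> j \<le> d \<Longrightarrow> Suc j < i \<Longrightarrow> \<phi> i (B (u j)) = 0"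
    and B_hess1: "Suc j \<le> d \<Longrightarrow> \<phi> (Suc j) (B (u j)) \<noteq> 0"
    and A_hess0: "i \<le> d \<Longrightarrow> j \<le> d \<Longrightarrow> Suc j < i \<Longrightarrow> \<psi> i (A (w j)) = 0"
    and A_hess1: "Suc j \<le> d \<Longrightarrow> \<psi> (Suc j) (A (w j)) \<noteq> 0"
begin

lemma dual: "hessenberg_pair s d B \<theta>' w \<psi> A \<theta> u \<phi>"
  by (intro hessenberg_pair.intro hessenberg_pair_axioms.intro A.eigenbasis_axioms B.eigenbasis_axioms
      B_hess0 B_hess1 A_hess0 A_hess1)

lemma B_coord:
  assumes "i \<le> d" shows "\<phi> i (B v) = (\<Sum>j\<le>d. \<phi> j v * \<phi> i (B (u j)))"
  by (rule A.functional_expansion)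
    (use assms in \<open>simp_all add: B.A_add B.A_scale A.coord_add A.coord_scale\<close>)

text \<open>A factor \<open>A\<close> to the left of \<open>B\<close> scales the
  \<open>(i, j)\<close> entry by \<open>\<theta> i\<close>, one to the right by
  \<open>\<theta> j\<close>.\<close>

lemma coord_td:
  assumes "i \<le> d" "j \<le> d"
  shows "\<phi> i (commutator A (td_expr s \<beta> \<gamma> \<rho> A B) (u j)) =
    (\<theta> i - \<theta> j) * ((\<theta> i)\<^sup>2 - \<beta> * \<theta> i * \<theta> j + (\<theta> j)\<^sup>2 - \<gamma> * (\<theta> i + \<theta> j) - \<rho>) * \<phi> i (B (u j))"
  using assms by (simp add: commutator_def td_expr_def A.eigenvector A.coord_A A.coord_diff
    A.coord_add A.coord_scale A.A_scale B.A_scale algebra_simps power2_eq_square)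

text \<open>The factor \<open>\<theta> i - \<theta> j\<close> in \<open>coord_td\<close> vanishes
  exactly on the diagonal, so only off-diagonal entries impose a condition.\<close>

lemma td_iff:
  "commutator A (td_expr s \<beta> \<gamma> \<rho> A B) = (\<lambda>v. 0) \<longleftrightarrow> (\<forall>i\<le>d. \<forall>j\<le>d. i \<noteq> j \<longrightarrow> \<phi> i (B (u j)) \<noteq> 0 \<longrightarrow>
    (\<theta> i)\<^sup>2 - \<beta> * \<theta> i * \<theta> j + (\<theta> j)\<^sup>2 - \<gamma> * (\<theta> i + \<theta> j) - \<rho> = 0)" (is "?L \<longleftrightarrow> ?R")
proof
  assume L: ?L
  show ?R
  proof (intro allI impI)
    fix i j assume ij: "i \<le> d" "j \<le> d" "i \<noteq> j" "\<phi> i (B (u j)) \<noteq> 0"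
    then show "(\<theta> i)\<^sup>2 - \<beta> * \<theta> i * \<theta> j + (\<theta> j)\<^sup>2 - \<gamma> * (\<theta> i + \<theta> j) - \<rho> = 0"
      using coord_td[of i j \<beta> \<gamma> \<rho>] A.eigenvalue_neq[of i j] by (simp add: L A.coord_zero)
  qed
next
  assume R: ?R
  show ?L
  proof (rule ext, rule A.eq_zeroI)
    fix v i assume i: "i \<le> d"
    let ?g = "\<lambda>v. \<phi> i (commutator A (td_expr s \<beta> \<gamma> \<rho> A B) v)"
    have "?g v = (\<Sum>j\<le>d. \<phi> j v * ?g (u j))"
      by (rule A.functional_expansion)
        (use i in \<open>simp_all add: commutator_def td_expr_def A.coord_A A.coord_diff A.coord_add
          A.coord_scale A.A_add A.A_diff A.A_scale B.A_add B.A_scale algebra_simps\<close>)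
    also have "\<dots> = 0"
    proof (rule sum.neutral, rule ballI)
      fix j assume "j \<in> {..d}"
      then show "\<phi> j v * ?g (u j) = 0"
        using R i coord_td[of i j \<beta> \<gamma> \<rho>] by (cases "i = j") auto
    qed
    finally show "?g v = 0" .
  qed
qed


lemma A_coord:
  assumes "i \<le> d" shows "\<psi> i (A v) = (\<Sum>j\<le>d. \<psi> j v * \<psi> i (A (w j)))"
  by (rule B.functional_expansion)
    (use assms in \<open>simp_all add: A.A_add A.A_scale B.coord_add B.coord_scale\<close>)

text \<open>Row \<open>i\<close> of \<open>A\<close> starts at column \<open>i - 1\<close>, so
  \<open>A\<close> extends the support by at most one index, and only the subdiagonal entry feeds
  the new top coordinate.\<close>

lemma A_raises_support:
  assumes "\<forall>i\<le>d. m < i \<longrightarrow> \<psi> i v = 0"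
  shows "\<forall>i\<le>d. Suc m < i \<longrightarrow> \<psi> i (A v) = 0"
    and "Suc m \<le> d \<Longrightarrow> \<psi> (Suc m) (A v) = \<psi> m v * \<psi> (Suc m) (A (w m))"
proof -
  show "\<forall>i\<le>d. Suc m < i \<longrightarrow> \<psi> i (A v) = 0"
  proof (intro allI impI)
    fix i assume i: "i \<le> d" "Suc m < i"
    have "\<psi> j v * \<psi> i (A (w j)) = 0" if "j \<le> d" for j
      using assms i that A_hess0[of i j] by (cases "m < j") auto
    then show "\<psi> i (A v) = 0" using i by (simp add: A_coord[of i v] sum.neutral)
  qed
  assume m: "Suc m \<le> d"
  have "\<psi> j v * \<psi> (Suc m) (A (w j)) = 0" if "j \<le> d" "j \<noteq> m" for j
    using assms m that A_hess0[of "Suc m" j] by (cases "m < j") auto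
  then have "(\<Sum>j\<in>{..d} - {m}. \<psi> j v * \<psi> (Suc m) (A (w j))) = 0"
    by (intro sum.neutral) auto
  then show "\<psi> (Suc m) (A v) = \<psi> m v * \<psi> (Suc m) (A (w m))"
    using m sum.remove[of "{..d}" m "\<lambda>j. \<psi> j v * \<psi> (Suc m) (A (w j))"]
    by (simp add: A_coord[of _ v])
qed

lemma B_keeps_support:
  assumes "\<forall>i\<le>d. m < i \<longrightarrow> \<psi> i v = 0"
  shows "\<forall>i\<le>d. m < i \<longrightarrow> \<psi> i (B v) = 0"
  using assms by (simp add: B.coord_A)

lemma basis0_support: "\<forall>i\<le>d. 0 < i \<longrightarrow> \<psi> i (w 0) = 0"
  by (simp add: B.coord_basis)

lemma A_funpow_support: "\<forall>i\<le>d. k < i \<longrightarrow> \<psi> i ((A ^^ k) (w 0)) = 0"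
  using A_raises_support(1) basis0_support by (induction k) auto

text \<open>This coordinate is a product of subdiagonal entries of \<open>A\<close>.\<close>

lemma A_funpow_top: "k \<le> d \<Longrightarrow> \<psi> k ((A ^^ k) (w 0)) \<noteq> 0"
  by (induction k) (auto simp: B.coord_basis A_raises_support(2)[OF A_funpow_support] A_hess1)

end

section \<open>From the quasi-circular shape to the TD relation\<close>

lemma lagrange_interpolation:
  fixes x y :: "nat \<Rightarrow> 'f::field"
  assumes "inj_on x {..n}"
  shows "\<exists>p. degree p \<le> n \<and> (\<forall>i\<le>n. poly p (x i) = y i)"
  using assms
proof (induction n)
  case 0
  show ?case by (rule exI[of _ "[:y 0:]"]) simp
next
  case (Suc n)
  then obtain p where p: "degree p \<le> n" "\<And>i. i \<le> n \<Longrightarrow> poly p (x i) = y i"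
    by (auto simp: inj_on_def)
  \<comment> \<open>A multiple of \<open>q\<close> corrects the value at the new node without
    disturbing the old ones.\<close>
  define q where "q = (\<Prod>i\<le>n. [:- x i, 1:])"
  have q0: "poly q (x i) = 0" if "i \<le> n" for i
    using that by (auto simp: q_def poly_prod)
  have q1: "poly q (x (Suc n)) \<noteq> 0"
    using Suc.prems by (fastforce simp: q_def poly_prod inj_on_def)
  have dq: "degree q = Suc n"
    by (simp add: q_def degree_prod_eq_sum_degree)
  let ?r = "p + smult ((y (Suc n) - poly p (x (Suc n))) / poly q (x (Suc n))) q"
  have "degree ?r \<le> Suc n"
    using p(1) dq by (intro degree_add_le) (auto intro: order.trans[OF degree_smult_le])
  moreover have "poly ?r (x i) = y i" if "i \<le> Suc n" for i
    using that p(2) q0 q1 by (cases "i = Suc n") auto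
  ultimately show ?case by blast
qed

context hessenberg_pair
begin

text \<open>The entry is a sum over closed walks through \<open>k\<close>, \<open>p\<close>,
  \<open>q\<close> with weight \<open>\<theta>' q - \<theta>' p\<close>. Walks with
  \<open>p = q\<close> have weight 0; without triangles the others have a loop at \<open>k\<close>,
  and reversal swaps the cases \<open>p = k\<close> and \<open>q = k\<close> with opposite
  weights.\<close>

lemma closed_3_walks_cancel:
  assumes "d \<ge> 3" and k: "k \<le> d"
    and cyclic: "\<And>i j. i \<le> d \<Longrightarrow> j \<le> d \<Longrightarrow> Suc i < j \<Longrightarrow> j - i < d \<Longrightarrow> \<psi> i (A (w j)) = 0"
  shows "\<psi> k (A (A (B (A (w k)))) - A (B (A (A (w k))))) = 0"
proof -
  define b where "b i j = \<psi> i (A (w j))" for i j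
  have b0: "b i j = 0" if "i \<le> d" "j \<le> d" "Suc j < i \<or> Suc i < j \<and> j - i < d" for i j
    using that A_hess0 cyclic by (auto simp: b_def)
  \<comment> \<open>A cycle of length \<open>d + 1 > 3\<close> has no triangles.\<close>
  have no_triangle: "b k p * b p q * b q k = 0"
    if "p \<le> d" "q \<le> d" "p \<noteq> k" "q \<noteq> k" "p \<noteq> q" for p q
  proof (rule ccontr)
    assume "b k p * b p q * b q k \<noteq> 0"
    then have "b k p \<noteq> 0" "b p q \<noteq> 0" "b q k \<noteq> 0" by auto
    then show False
      using b0[of k p] b0[of p q] b0[of q k] that k \<open>d \<ge> 3\<close> by linarith
  qed
  have "\<psi> k (A (A (B (A (w k)))) - A (B (A (A (w k))))) =
      (\<Sum>p\<le>d. \<Sum>q\<le>d. b k p * b p q * b q k * (\<theta>' q - \<theta>' p))"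
    using k by (simp add: B.coord_diff A_coord[of _ "A _"] A_coord[of _ "B _"] B.coord_A
        sum_distrib_left sum_distrib_right flip: b_def sum_subtractf)
      (simp add: algebra_simps)
  also have "\<dots> = (\<Sum>p\<le>d. \<Sum>q\<le>d. (if p = k then b k k * b k q * b q k * (\<theta>' q - \<theta>' k) else 0)
      + (if q = k then b k p * b p k * b k k * (\<theta>' k - \<theta>' p) else 0))"
  proof (intro sum.cong refl)
    fix p q assume "p \<in> {..d}" "q \<in> {..d}"
    then show "b k p * b p q * b q k * (\<theta>' q - \<theta>' p) =
      (if p = k then b k k * b k q * b q k * (\<theta>' q - \<theta>' k) else 0)
      + (if q = k then b k p * b p k * b k k * (\<theta>' k - \<theta>' p) else 0)"
      using no_triangle[of p q] by (cases "p = q") auto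
  qed
  also have "\<dots> = (\<Sum>q\<le>d. b k k * b k q * b q k * (\<theta>' q - \<theta>' k))
      + (\<Sum>p\<le>d. b k p * b p k * b k k * (\<theta>' k - \<theta>' p))"
  proof -
    have "(\<Sum>q\<le>d. if p = k then f q else 0) = (if p = k then sum f {..d} else (0::'f))" for p f
      by simp
    then show ?thesis using k by (simp add: sum.distrib)
  qed
  also have "\<dots> = 0"
    by (simp add: algebra_simps flip: sum.distrib)
  finally show ?thesis .
qed

text \<open>The equation for \<beta>, taken for the dual pair, later serves to match the values of
  \<beta> in the two TD relations.\<close>

lemma quasi_circular_recurrence:
  assumes d: "d \<ge> 3"
    and B_cyclic: "\<And>i j. i \<le> d \<Longrightarrow> j \<le> d \<Longrightarrow> Suc i < j \<Longrightarrow> j - i < d \<Longrightarrow> \<phi> i (B (u j)) = 0"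
    and A_cyclic: "\<And>i j. i \<le> d \<Longrightarrow> j \<le> d \<Longrightarrow> Suc i < j \<Longrightarrow> j - i < d \<Longrightarrow> \<psi> i (A (w j)) = 0"
  shows "\<exists>\<beta> \<gamma> \<rho>. commutator A (td_expr s \<beta> \<gamma> \<rho> A B) = (\<lambda>v. 0) \<and>
    (\<beta> + 1) * (\<theta>' 1 - \<theta>' 2) = \<theta>' 0 - \<theta>' 3"
proof -
  define a where "a i j = \<phi> i (B (u j))" for i j
  \<comment> \<open>The increments are the values of
    \<open>\<theta> i ^ 2 * \<theta> j - \<theta> i * \<theta> j ^ 2\<close> at
    \<open>i = Suc j\<close>, so \<open>e\<close> below vanishes between neighbours.\<close>
  define z where "z i = (\<Sum>j<i. \<theta> j * \<theta> (Suc j) * (\<theta> (Suc j) - \<theta> j))" for i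
  obtain p where p: "degree p \<le> d" "\<And>i. i \<le> d \<Longrightarrow> poly p (\<theta> i) = z i"
    using lagrange_interpolation[OF A.inj_eigenvalues] by blast
  \<comment> \<open>Writing the diagonal map as a polynomial in \<open>A\<close> lets its degree be
    read off in the eigenbasis of \<open>B\<close>.\<close>
  define Z where "Z v = (\<Sum>k\<le>d. s (coeff p k) ((A ^^ k) v))" for v
  have Z_scale: "Z (s c v) = s c (Z v)" for c v
  proof -
    have "(A ^^ k) (s c v) = s c ((A ^^ k) v)" for k
      by (induction k) (auto simp: A.A_scale)
    then show ?thesis by (simp add: Z_def A.scale_sum_right mult.commute)
  qed
  have coord_Z: "\<phi> i (Z v) = z i * \<phi> i v" if "i \<le> d" for i v
  proof -
    have "\<phi> i (Z v) = (\<Sum>k\<le>d. coeff p k * \<theta> i ^ k) * \<phi> i v"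
      using that by (simp add: Z_def A.coord_sum A.coord_scale A.coord_A_funpow sum_distrib_right
          mult.assoc)
    also have "(\<Sum>k\<le>d. coeff p k * \<theta> i ^ k) = poly p (\<theta> i)"
      unfolding poly_altdef by (rule sum.mono_neutral_right) (use p in \<open>auto simp: coeff_eq_0\<close>)
    finally show ?thesis using p that by simp
  qed
  \<comment> \<open>The choice of \<open>z\<close> kills every entry of \<open>D\<close> in the eigenbasis of \<open>A\<close> except the corner
    \<open>(0, d)\<close>; the corner is ruled out in the eigenbasis of \<open>B\<close>.\<close>
  define D where "D v = A (A (B (A v))) - A (B (A (A v))) - (Z (B v) - B (Z v))" for v
  define e where "e i j = \<theta> i ^ 2 * \<theta> j - \<theta> i * \<theta> j ^ 2 - z i + z j" for i j
  have coord_D: "\<phi> i (D v) = (\<Sum>j\<le>d. \<phi> j v * (a i j * e i j))" if "i \<le> d" for i v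
    using that
    by (simp add: D_def A.coord_diff A.coord_A coord_Z B_coord[of _ "A _"] B_coord[of _ "Z _"] B_coord[of _ v]
        sum_distrib_left flip: a_def sum_subtractf)
      (simp add: e_def algebra_simps power2_eq_square)
  have ae: "a i j * e i j = 0" if ij: "i \<le> d" "j \<le> d" "\<not> (i = 0 \<and> j = d)" for i j
  proof -
    consider "i = j" | "i = Suc j" | "j = Suc i" | "Suc j < i" | "Suc i < j \<and> j - i < d"
      using ij by linarith
    then show ?thesis
    proof cases
      case 1 then show ?thesis by (simp add: e_def power2_eq_square)
    next
      case 2 then show ?thesis by (simp add: e_def z_def power2_eq_square algebra_simps)
    next
      case 3 then show ?thesis by (simp add: e_def z_def power2_eq_square algebra_simps)
    next
      case 4 then show ?thesis using ij B_hess0 by (simp add: a_def)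
    next
      case 5 then show ?thesis using ij B_cyclic by (simp add: a_def)
    qed
  qed
  define \<kappa> where "\<kappa> = a 0 d * e 0 d"
  have D_rank1: "D v = s (\<kappa> * \<phi> d v) (u 0)" for v
  proof -
    have "D v - s (\<kappa> * \<phi> d v) (u 0) = 0"
    proof (rule A.eq_zeroI)
      fix i assume i: "i \<le> d"
      have "\<phi> i (D v) = (\<Sum>j\<le>d. if j = d then (if i = 0 then \<kappa> * \<phi> d v else 0) else 0)"
        unfolding coord_D[OF i] by (rule sum.cong) (use i ae in \<open>auto simp: \<kappa>_def\<close>)
      then show "\<phi> i (D v - s (\<kappa> * \<phi> d v) (u 0)) = 0"
        using i by (simp add: A.coord_diff A.coord_scale A.coord_basis)
    qed
    then show ?thesis by simp
  qed
  have "\<kappa> = 0"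
  proof -
    interpret dual: hessenberg_pair s d B \<theta>' w \<psi> A \<theta> u \<phi> by (rule dual)
    \<comment> \<open>This is the \<open>k\<close>-th diagonal entry of the rank-one map
      \<open>D\<close> in the eigenbasis of \<open>B\<close>.\<close>
    have diag: "\<kappa> * \<phi> d (w k) * \<psi> k (u 0) = 0" if k: "k \<le> d" for k
    proof -
      have "\<psi> k (B (Z (w k))) = \<psi> k (Z (B (w k)))"
        using k by (simp add: B.coord_A B.eigenvector Z_scale B.coord_scale)
      then have "\<psi> k (D (w k)) = 0"
        using closed_3_walks_cancel[OF d k A_cyclic] k by (simp add: D_def B.coord_diff)
      then show ?thesis using k by (simp add: D_rank1 B.coord_scale mult.assoc)
    qed
    \<comment> \<open>Both sides are the trace of \<open>D\<close> times \<open>B ^^ d\<close>,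
      computed in the two eigenbases.\<close>
    have "\<kappa> * \<phi> d ((B ^^ d) (u 0)) = (\<Sum>k\<le>d. \<theta>' k ^ d * (\<kappa> * \<phi> d (w k) * \<psi> k (u 0)))"
      by (subst B.functional_expansion[of "\<phi> d"])
        (auto simp: A.coord_add A.coord_scale B.coord_A_funpow sum_distrib_left mult_ac)
    also have "\<dots> = 0" by (simp add: diag)
    finally show ?thesis using dual.A_funpow_top[of d] by simp
  qed
  then have D0: "A (A (B (A v))) - A (B (A (A v))) = Z (B v) - B (Z v)" for v
    using D_rank1[of v] by (simp add: D_def)
  \<comment> \<open>Powers of \<open>A\<close> below \<open>k\<close> do not reach index
    \<open>k\<close>, and those above have coefficient 0.\<close>
  have Z_top: "\<psi> k (Z (w 0)) = coeff p k * \<psi> k ((A ^^ k) (w 0))"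
    if k: "k \<le> d" "\<forall>m>k. coeff p m = 0" for k
  proof -
    have "\<psi> k (Z (w 0)) = (\<Sum>m\<le>d. coeff p m * \<psi> k ((A ^^ m) (w 0)))"
      using k by (simp add: Z_def B.coord_sum B.coord_scale)
    also have "\<dots> = (\<Sum>m\<le>d. if m = k then coeff p k * \<psi> k ((A ^^ k) (w 0)) else 0)"
    proof (intro sum.cong refl)
      fix m
      show "coeff p m * \<psi> k ((A ^^ m) (w 0)) =
          (if m = k then coeff p k * \<psi> k ((A ^^ k) (w 0)) else 0)"
        using k A_funpow_support[of m] by (cases m k rule: linorder_cases) auto
    qed
    finally show ?thesis using k by simp
  qed
  have entry: "\<psi> k (A (A (B (A (w 0))))) - \<psi> k (A (B (A (A (w 0))))) = (\<theta>' 0 - \<theta>' k) * \<psi> k (Z (w 0))"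
    if "k \<le> d" for k
  proof -
    have "Z (B (w 0)) = s (\<theta>' 0) (Z (w 0))" by (simp add: B.eigenvector Z_scale)
    then show ?thesis using that arg_cong[OF D0[of "w 0"], of "\<psi> k"]
      by (simp add: B.coord_diff B.coord_scale B.coord_A algebra_simps)
  qed
  note supp1 = A_raises_support(1)[OF basis0_support]
  note supp2l = A_raises_support(1)[OF B_keeps_support[OF supp1]]
  note supp2r = B_keeps_support[OF A_raises_support(1)[OF supp1]]
  \<comment> \<open>Three factors \<open>A\<close> carry \<open>w 0\<close> no further than index 3,
    whereas a higher degree would make a higher coordinate of \<open>Z (w 0)\<close>
    nonzero.\<close>
  have deg: "degree p \<le> 3"
  proof (rule ccontr)
    define k where "k = degree p"
    assume "\<not> degree p \<le> 3"
    then have k: "3 < k" "k \<le> d" "coeff p k \<noteq> 0"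
      using p(1) by (auto simp: k_def)
    have "\<psi> k (A (A (B (A (w 0))))) = 0" "\<psi> k (A (B (A (A (w 0))))) = 0"
      using A_raises_support(1)[OF supp2l] A_raises_support(1)[OF supp2r] k by auto
    moreover have "\<psi> k (Z (w 0)) \<noteq> 0"
      using Z_top[of k] A_funpow_top[of k] k by (auto simp: k_def coeff_eq_0)
    moreover have "\<theta>' 0 \<noteq> \<theta>' k" using B.eigenvalue_neq[of 0 k] k by simp
    ultimately show False using entry[of k] k by simp
  qed
  define \<eta> where "\<eta> = coeff p 3"
  have "(\<theta>' 1 - \<theta>' 2) * \<psi> 3 ((A ^^ 3) (w 0)) = (\<theta>' 0 - \<theta>' 3) * (\<eta> * \<psi> 3 ((A ^^ 3) (w 0)))"
  proof -
    define h where "h = \<psi> 1 (A (w 0)) * \<psi> 2 (A (w 1)) * \<psi> 3 (A (w 2))"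
    have psi2: "\<psi> 2 (A (B (A (w 0)))) = \<theta>' 1 * \<psi> 1 (A (w 0)) * \<psi> 2 (A (w 1))"
      "\<psi> 2 (A (A (w 0))) = \<psi> 1 (A (w 0)) * \<psi> 2 (A (w 1))"
      using A_raises_support(2)[OF B_keeps_support[OF supp1]] A_raises_support(2)[OF supp1] d
      by (auto simp: numeral_2_eq_2 numeral_3_eq_3 B.coord_A)
    have "\<psi> 3 (A (A (B (A (w 0))))) = \<theta>' 1 * h" "\<psi> 3 (A (B (A (A (w 0))))) = \<theta>' 2 * h"
      "\<psi> 3 ((A ^^ 3) (w 0)) = h"
      using A_raises_support(2)[OF supp2l] A_raises_support(2)[OF supp2r]
        A_raises_support(2)[OF A_raises_support(1)[OF supp1]] d psi2
      by (auto simp: numeral_2_eq_2 numeral_3_eq_3 B.coord_A h_def)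
    then show ?thesis
      using entry[of 3] Z_top[of 3] d deg by (simp add: \<eta>_def coeff_eq_0 algebra_simps)
  qed
  then have \<eta>: "\<theta>' 1 - \<theta>' 2 = (\<theta>' 0 - \<theta>' 3) * \<eta>"
    using A_funpow_top[OF d] by simp
  then have "\<eta> \<noteq> 0" using B.eigenvalue_neq[of 1 2] d by auto
  have z_eq: "z i = coeff p 0 + coeff p 1 * \<theta> i + coeff p 2 * \<theta> i ^ 2 + \<eta> * \<theta> i ^ 3"
    if "i \<le> d" for i
  proof -
    have "poly p (\<theta> i) = (\<Sum>k\<le>3. coeff p k * \<theta> i ^ k)"
      unfolding poly_altdef by (rule sum.mono_neutral_left) (use deg in \<open>auto simp: coeff_eq_0\<close>)
    then show ?thesis using p(2)[OF that] by (simp add: \<eta>_def numeral_2_eq_2 numeral_3_eq_3)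
  qed
  \<comment> \<open>With the cubic form of \<open>z\<close>, these are the coefficients obtained on
    dividing \<open>e i j\<close> by \<open>- \<eta> * (\<theta> i - \<theta> j)\<close>.\<close>
  define \<beta> \<gamma> \<rho> where "\<beta> = 1 / \<eta> - 1" and "\<gamma> = - coeff p 2 / \<eta>" and "\<rho> = - coeff p 1 / \<eta>"
  have "(\<theta> i)\<^sup>2 - \<beta> * \<theta> i * \<theta> j + (\<theta> j)\<^sup>2 - \<gamma> * (\<theta> i + \<theta> j) - \<rho> = 0"
    if ij: "i \<le> d" "j \<le> d" "i \<noteq> j" "\<phi> i (B (u j)) \<noteq> 0" for i j
  proof -
    have "a i j * e i j = 0"
      using ij ae[of i j] \<open>\<kappa> = 0\<close> by (cases "i = 0 \<and> j = d") (auto simp: \<kappa>_def)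
    then have e0: "e i j = 0" using ij by (simp add: a_def)
    have "\<eta> * (\<theta> i - \<theta> j) * ((\<theta> i)\<^sup>2 - \<beta> * \<theta> i * \<theta> j + (\<theta> j)\<^sup>2 - \<gamma> * (\<theta> i + \<theta> j) - \<rho>) = - e i j"
      using \<open>\<eta> \<noteq> 0\<close> ij
      by (simp add: e_def z_eq \<beta>_def \<gamma>_def \<rho>_def field_simps power2_eq_square power3_eq_cube)
    then show ?thesis using e0 \<open>\<eta> \<noteq> 0\<close> A.eigenvalue_neq[of i j] ij by simp
  qed
  then have "commutator A (td_expr s \<beta> \<gamma> \<rho> A B) = (\<lambda>v. 0)"
    unfolding td_iff by blast
  moreover have "(\<beta> + 1) * (\<theta>' 1 - \<theta>' 2) = \<theta>' 0 - \<theta>' 3"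
    using \<eta> \<open>\<eta> \<noteq> 0\<close> by (simp add: \<beta>_def)
  ultimately show ?thesis by blast
qed

section \<open>Consequences of the TD relation\<close>

lemma td_step:
  assumes "commutator A (td_expr s \<beta> \<gamma> \<rho> A B) = (\<lambda>v. 0)" "Suc i \<le> d"
  shows "(\<theta> (Suc i))\<^sup>2 - \<beta> * \<theta> (Suc i) * \<theta> i + (\<theta> i)\<^sup>2 - \<gamma> * (\<theta> (Suc i) + \<theta> i) - \<rho> = 0"
  using assms B_hess1[of i] unfolding td_iff by (metis Suc_leD n_not_Suc_n)

text \<open>Vieta: \<open>\<theta> i\<close> and \<open>\<theta> (Suc (Suc i))\<close> are the two
  distinct roots of the quadratic attached to the eigenvalue between them.\<close>

lemma td_three_term:
  assumes "commutator A (td_expr s \<beta> \<gamma> \<rho> A B) = (\<lambda>v. 0)" "Suc (Suc i) \<le> d"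
  shows "\<theta> i + \<theta> (Suc (Suc i)) = \<beta> * \<theta> (Suc i) + \<gamma>"
proof -
  have "(\<theta> (Suc (Suc i)) - \<theta> i) * (\<theta> i + \<theta> (Suc (Suc i)) - (\<beta> * \<theta> (Suc i) + \<gamma>)) = 0"
    using td_step[OF assms(1), of i] td_step[OF assms(1), of "Suc i"] assms(2)
    by (simp add: algebra_simps power2_eq_square) algebra
  then show ?thesis using A.eigenvalue_neq[of "Suc (Suc i)" i] assms(2) by simp
qed

text \<open>Subtracting two successive three-term relations eliminates \<gamma>.\<close>

lemma td_beta:
  assumes "commutator A (td_expr s \<beta> \<gamma> \<rho> A B) = (\<lambda>v. 0)" "d \<ge> 3"
  shows "(\<beta> + 1) * (\<theta> 1 - \<theta> 2) = \<theta> 0 - \<theta> 3"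
proof -
  have "\<theta> 0 + \<theta> 2 = \<beta> * \<theta> 1 + \<gamma>" "\<theta> 1 + \<theta> 3 = \<beta> * \<theta> 2 + \<gamma>"
    using td_three_term[OF assms(1), of 0] td_three_term[OF assms(1), of 1] assms(2)
    by (simp_all add: numeral_2_eq_2 numeral_3_eq_3)
  then show ?thesis by algebra
qed

lemma td_vanish:
  assumes td: "commutator A (td_expr s \<beta> \<gamma> \<rho> A B) = (\<lambda>v. 0)"
    and ij: "j \<le> d" "Suc i < j" "j - i < d"
  shows "\<phi> i (B (u j)) = 0"
proof (rule ccontr)
  assume "\<phi> i (B (u j)) \<noteq> 0"
  then have P: "(\<theta> i)\<^sup>2 - \<beta> * \<theta> i * \<theta> j + (\<theta> j)\<^sup>2 - \<gamma> * (\<theta> i + \<theta> j) - \<rho> = 0"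
    using td ij unfolding td_iff by auto
  show False
  \<comment> \<open>The root count needs an interior index: \<open>i\<close> if it is positive, and
    otherwise \<open>j\<close>, since then \<open>j - i < d\<close> gives
    \<open>j < d\<close>.\<close>
  proof (cases i)
    case (Suc m)
    have "\<theta> m + \<theta> (Suc i) = \<beta> * \<theta> i + \<gamma>"
      using td_three_term[OF td, of m] Suc ij by simp
    moreover have "(\<theta> i)\<^sup>2 - \<beta> * \<theta> i * \<theta> m + (\<theta> m)\<^sup>2 - \<gamma> * (\<theta> i + \<theta> m) - \<rho> = 0"
      using td_step[OF td, of m] Suc ij by simp
    ultimately have "(\<theta> j - \<theta> m) * (\<theta> j - \<theta> (Suc i)) = 0"
      using P by algebra
    then show False using A.eigenvalue_neq[of j m] A.eigenvalue_neq[of j "Suc i"] Suc ij by auto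
  next
    case 0
    obtain m where m: "j = Suc m" using ij by (cases j) auto
    have "\<theta> m + \<theta> (Suc j) = \<beta> * \<theta> j + \<gamma>"
      using td_three_term[OF td, of m] m ij 0 by simp
    moreover have "(\<theta> j)\<^sup>2 - \<beta> * \<theta> j * \<theta> m + (\<theta> m)\<^sup>2 - \<gamma> * (\<theta> j + \<theta> m) - \<rho> = 0"
      using td_step[OF td, of m] m ij by simp
    ultimately have "(\<theta> i - \<theta> m) * (\<theta> i - \<theta> (Suc j)) = 0"
      using P by algebra
    then show False using A.eigenvalue_neq[of i m] A.eigenvalue_neq[of i "Suc j"] m ij 0 by auto
  qed
qed

lemma td_dim3:
  assumes "d = 2"
  shows "\<exists>\<gamma> \<rho>. commutator A (td_expr s (-1) \<gamma> \<rho> A B) = (\<lambda>v. 0)"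
proof -
  \<comment> \<open>Up to sign, the first two elementary symmetric functions of the
    eigenvalues.\<close>
  let ?\<gamma> = "\<theta> 0 + \<theta> 1 + \<theta> 2" and ?\<rho> = "- (\<theta> 0 * \<theta> 1 + \<theta> 0 * \<theta> 2 + \<theta> 1 * \<theta> 2)"
  have "(\<theta> i)\<^sup>2 - (-1) * \<theta> i * \<theta> j + (\<theta> j)\<^sup>2 - ?\<gamma> * (\<theta> i + \<theta> j) - ?\<rho> = 0"
    if "i \<le> d" "j \<le> d" "i \<noteq> j" for i j
  proof -
    have "i \<in> {0, 1, 2}" "j \<in> {0, 1, 2}" using that assms by auto
    then show ?thesis using that by (auto simp: algebra_simps power2_eq_square)
  qed
  then show ?thesis unfolding td_iff by blast
qed

end

section \<open>Translation to idempotents and conclusion\<close>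

text \<open>The sandwich is the scalar \<open>\<phi> i (B (u j))\<close> times the nonzero map
  sending \<open>v\<close> to \<open>s (\<phi> j v) (u i)\<close>.\<close>

lemma idempotent_sandwich_zero_iff:
  assumes "eigenbasis s d A \<theta> u \<phi>" "eigenbasis s d B \<theta>' w \<psi>"
    and E: "\<And>i v. i \<le> d \<Longrightarrow> E i v = s (\<phi> i v) (u i)"
    and "i \<le> d" "j \<le> d" "u i \<noteq> 0"
  shows "E i \<circ> B \<circ> E j = (\<lambda>v. 0) \<longleftrightarrow> \<phi> i (B (u j)) = 0"
proof -
  interpret A: eigenbasis s d A \<theta> u \<phi> by fact
  interpret B: eigenbasis s d B \<theta>' w \<psi> by fact
  have "(E i \<circ> B \<circ> E j) v = s (\<phi> j v * \<phi> i (B (u j))) (u i)" for v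
    using assms(4,5) by (simp add: E B.A_scale A.coord_scale)
  then show ?thesis
    using assms(4-6) by (auto simp: fun_eq_iff A.coord_basis dest: spec[of _ "u j"])
qed

theorem mainTheorem1:
  fixes s :: "'f::field \<Rightarrow> 'v::ab_group_add \<Rightarrow> 'v"
    and d :: nat
    and A As :: "'v \<Rightarrow> 'v"
    and E Es :: "nat \<Rightarrow> 'v \<Rightarrow> 'v"
  assumes "d \<ge> 2"
    and "vector_space s"
    and "vector_space.dim s (UNIV :: 'v set) = d + 1"
    and "hessenberg_system s d A E As Es"
  shows "QCHS s d A E As Es \<longleftrightarrow> TD s d A E As Es"
proof -
  note H = assms(4)[unfolded hessenberg_system_def]
  obtain \<theta> u \<phi> where A: "eigenbasis s d A \<theta> u \<phi>" "\<And>i v. i \<le> d \<Longrightarrow> E i v = s (\<phi> i v) (u i)"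
    "\<And>i. i \<le> d \<Longrightarrow> u i \<noteq> 0"
    using eigenbasis_exists[OF assms(2), of A d E] H by blast
  obtain \<theta>' w \<psi> where B: "eigenbasis s d As \<theta>' w \<psi>" "\<And>i v. i \<le> d \<Longrightarrow> Es i v = s (\<psi> i v) (w i)"
    "\<And>i. i \<le> d \<Longrightarrow> w i \<noteq> 0"
    using eigenbasis_exists[OF assms(2), of As d Es] H by blast
  note E_iff = idempotent_sandwich_zero_iff[OF A(1) B(1), of E, OF A(2) _ _ A(3)]
  note Es_iff = idempotent_sandwich_zero_iff[OF B(1) A(1), of Es, OF B(2) _ _ B(3)]
  interpret hessenberg_pair s d A \<theta> u \<phi> As \<theta>' w \<psi>
  proof (intro hessenberg_pair.intro hessenberg_pair_axioms.intro A(1) B(1))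
    fix i j assume "i \<le> d" "j \<le> d" "Suc j < i"
    then show "\<phi> i (As (u j)) = 0" "\<psi> i (A (w j)) = 0"
      using H by (simp_all flip: E_iff Es_iff)
  next
    fix j assume "Suc j \<le> d"
    then show "\<phi> (Suc j) (As (u j)) \<noteq> 0" "\<psi> (Suc j) (A (w j)) \<noteq> 0"
      using H by (simp_all flip: E_iff Es_iff)
  qed
  interpret dual: hessenberg_pair s d As \<theta>' w \<psi> A \<theta> u \<phi> by (rule dual)
  have QCHS_iff: "QCHS s d A E As Es \<longleftrightarrow> (\<forall>i\<le>d. \<forall>j\<le>d. Suc i < j \<and> j - i < d \<longrightarrow>
      \<phi> i (As (u j)) = 0 \<and> \<psi> i (A (w j)) = 0)"
  proof -
    have "1 < int j - int i \<and> int j - int i < int d \<longleftrightarrow> Suc i < j \<and> j - i < d" for i j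
      by linarith
    then show ?thesis using assms(4) by (simp add: QCHS_def E_iff Es_iff)
  qed
  show ?thesis
  proof
    assume "TD s d A E As Es"
    then show "QCHS s d A E As Es"
      unfolding QCHS_iff TD_def using td_vanish dual.td_vanish by blast
  next
    assume Q: "QCHS s d A E As Es"
    show "TD s d A E As Es"
    proof (cases "d = 2")
      case True
      then show ?thesis
        unfolding TD_def using assms(4) td_dim3 dual.td_dim3 by blast
    next
      case False
      then have d: "d \<ge> 3" using assms(1) by simp
      obtain \<beta> \<gamma> \<rho> where 1: "commutator A (td_expr s \<beta> \<gamma> \<rho> A As) = (\<lambda>v. 0)"
        using quasi_circular_recurrence[OF d] Q unfolding QCHS_iff by blast
      obtain \<beta>' \<gamma>' \<rho>' where 2: "commutator As (td_expr s \<beta>' \<gamma>' \<rho>' As A) = (\<lambda>v. 0)"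
        "(\<beta>' + 1) * (\<theta> 1 - \<theta> 2) = \<theta> 0 - \<theta> 3"
        using dual.quasi_circular_recurrence[OF d] Q unfolding QCHS_iff by blast
      have "(\<beta>' + 1) * (\<theta> 1 - \<theta> 2) = (\<beta> + 1) * (\<theta> 1 - \<theta> 2)"
        using td_beta[OF 1 d] 2(2) by simp
      then have "\<beta>' = \<beta>" using A.eigenvalue_neq[of 1 2] d by simp
      then show ?thesis unfolding TD_def using assms(4) 1 2(1) by blast
    qed
  qed
qed

end
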